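(* Let $p>a\ge 1$ be integers and let $B(p,a)=(\sigma_1\sigma_2\cdots\sigma_{p-1})^a$, a $p$-braid. If the crossings of $B(p,a)$ at the positions in the $U$-crossing data $U(B(p,a))$ are changed, the resulting braid is Markov equivalent to the $a$-braid $B(a,p-a)=(\sigma_1\sigma_2\cdots\sigma_{a-1})^{p-a}$.
   Context: $\sigma_1,\dots,\sigma_{n-1}$ denote the elementary generators of the $n$-string braid group $\mathbb{B}_n$; empty products are trivial. The crossings of a braid word are numbered $1,2,3,\dots$ in the order of its letters; changing the crossing at position $k$ means replacing the $k$-th letter by its inverse. For $p\ge a$, the $U$-crossing data of $B(p,a)$ is the set of positions $U(B(p,a))=\{\,i(p-1)-t : 2\le i\le a,\ 0\le t\le i-2\,\}$ (empty if $a=1$), i.e. for each $i=2,\dots,a$ the last $i-1$ crossings of the $i$-th factor $\sigma_1\cdots\sigma_{p-1}$. Markov equivalence $\sim_M$ is the equivalence relation on $\bigsqcup_n\mathbb{B}_n$ generated by conjugation ($\beta\sim_M\gamma\beta\gamma^{-1}$ for $\beta,\gamma\in\mathbb{B}_n$) and stabilization ($\beta\sim_M\beta\sigma_n^{\pm1}$ for $\beta\in\mathbb{B}_n$, with $\beta\sigma_n^{\pm 1}\in\mathbb{B}_{n+1}$). *)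

theory Defs
  imports "HOL-Algebra.Group"
begin

text \<open>The letter \<open>(i, True)\<close> stands for the generator \<open>\<sigma>\<^sub>i\<close> and \<open>(i, False)\<close> for its inverse;
  generators are indexed from \<open>1\<close>.\<close>

type_synonym braid_letter = "nat \<times> bool"
type_synonym braid_word = "braid_letter list"

definition inv_letter :: "braid_letter \<Rightarrow> braid_letter" where
  "inv_letter l = (fst l, \<not> snd l)"

definition braid_words :: "nat \<Rightarrow> braid_word set" where
  "braid_words n = lists ({i. 1 \<le> i \<and> i < n} \<times> UNIV)"

text \<open>Artin's presentation of the \<open>n\<close>-string braid group, together with the free cancellation of a
  letter against its inverse.\<close>

inductive artin_relation :: "nat \<Rightarrow> braid_word \<Rightarrow> braid_word \<Rightarrow> bool" for n :: nat where
  cancel: "[l] \<in> braid_words n \<Longrightarrow> artin_relation n [l, inv_letter l] []"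
| commute: "1 \<le> i \<Longrightarrow> i + 2 \<le> j \<Longrightarrow> j < n \<Longrightarrow>
    artin_relation n [(i, True), (j, True)] [(j, True), (i, True)]"
| braid: "1 \<le> i \<Longrightarrow> i + 1 < n \<Longrightarrow>
    artin_relation n [(i, True), (i + 1, True), (i, True)] [(i + 1, True), (i, True), (i + 1, True)]"

inductive_set braid_rel :: "nat \<Rightarrow> (braid_word \<times> braid_word) set" for n :: nat where
  refl: "w \<in> braid_words n \<Longrightarrow> (w, w) \<in> braid_rel n"
| sym: "(u, v) \<in> braid_rel n \<Longrightarrow> (v, u) \<in> braid_rel n"
| trans: "(u, v) \<in> braid_rel n \<Longrightarrow> (v, w) \<in> braid_rel n \<Longrightarrow> (u, w) \<in> braid_rel n"
| step: "x \<in> braid_words n \<Longrightarrow> y \<in> braid_words n \<Longrightarrow> artin_relation n l r \<Longrightarrow>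
    (x @ l @ y, x @ r @ y) \<in> braid_rel n"

definition braid_of_word :: "nat \<Rightarrow> braid_word \<Rightarrow> braid_word set" where
  "braid_of_word n w = braid_rel n `` {w}"

definition braid_group :: "nat \<Rightarrow> braid_word set monoid" where
  "braid_group n =
    \<lparr>carrier = braid_words n // braid_rel n,
     monoid.mult = (\<lambda>\<beta> \<gamma>. braid_rel n `` {u @ v | u v. u \<in> \<beta> \<and> v \<in> \<gamma>}),
     one = braid_of_word n []\<rparr>"

definition braid_gen :: "nat \<Rightarrow> nat \<Rightarrow> braid_word set" where
  "braid_gen n i = braid_of_word n [(i, True)]"

text \<open>The homomorphism from the \<open>n\<close>-string to the \<open>(n+1)\<close>-string braid group that sends each
  generator to the generator of the same index.\<close>

definition braid_incl :: "nat \<Rightarrow> braid_word set \<Rightarrow> braid_word set" where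
  "braid_incl n \<beta> = braid_rel (n + 1) `` \<beta>"

text \<open>A point of the disjoint union of the braid groups is a pair of a number \<open>n \<ge> 1\<close> of strings
  and an element of the \<open>n\<close>-string braid group.\<close>

inductive markov_move :: "nat \<times> braid_word set \<Rightarrow> nat \<times> braid_word set \<Rightarrow> bool" where
  conjugation: "1 \<le> n \<Longrightarrow> \<beta> \<in> carrier (braid_group n) \<Longrightarrow> \<gamma> \<in> carrier (braid_group n) \<Longrightarrow>
    markov_move (n, \<beta>)
      (n, \<gamma> \<otimes>\<^bsub>braid_group n\<^esub> \<beta> \<otimes>\<^bsub>braid_group n\<^esub> inv\<^bsub>braid_group n\<^esub> \<gamma>)"
| stabilization_pos: "1 \<le> n \<Longrightarrow> \<beta> \<in> carrier (braid_group n) \<Longrightarrow>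
    markov_move (n, \<beta>)
      (n + 1, braid_incl n \<beta> \<otimes>\<^bsub>braid_group (n + 1)\<^esub> braid_gen (n + 1) n)"
| stabilization_neg: "1 \<le> n \<Longrightarrow> \<beta> \<in> carrier (braid_group n) \<Longrightarrow>
    markov_move (n, \<beta>)
      (n + 1, braid_incl n \<beta> \<otimes>\<^bsub>braid_group (n + 1)\<^esub>
        inv\<^bsub>braid_group (n + 1)\<^esub> braid_gen (n + 1) n)"

definition markov_equiv :: "nat \<times> braid_word set \<Rightarrow> nat \<times> braid_word set \<Rightarrow> bool" where
  "markov_equiv = equivclp markov_move"

text \<open>Crossings are properties of words, not of braids, so \<open>B(p,a)\<close> is kept as a word.\<close>

definition torus_word :: "nat \<Rightarrow> nat \<Rightarrow> braid_word" where
  "torus_word p a = concat (replicate a (map (\<lambda>i. (i, True)) [1..<p]))"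

definition change_crossings :: "nat set \<Rightarrow> braid_word \<Rightarrow> braid_word" where
  "change_crossings S w = map (\<lambda>(k, l). if k \<in> S then inv_letter l else l) (enumerate 1 w)"

text \<open>For \<open>p \<ge> a\<close> the natural-number subtractions below never truncate.\<close>

definition U_data :: "nat \<Rightarrow> nat \<Rightarrow> nat set" where
  "U_data p a = {i * (p - 1) - t | i t. 2 \<le> i \<and> i \<le> a \<and> t \<le> i - 2}"


subsection \<open>The braid groups are groups, presented as intended\<close>

lemma braid_words_append [simp]:
  "u @ v \<in> braid_words n \<longleftrightarrow> u \<in> braid_words n \<and> v \<in> braid_words n"
  by (simp add: braid_words_def)

lemma braid_words_Nil [simp]: "[] \<in> braid_words n"
  by (simp add: braid_words_def)

lemma braid_words_Cons [simp]:
  "l # w \<in> braid_words n \<longleftrightarrow> 1 \<le> fst l \<and> fst l < n \<and> w \<in> braid_words n"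
  by (cases l) (auto simp: braid_words_def)

lemma artin_relation_words:
  "artin_relation n l r \<Longrightarrow> l \<in> braid_words n \<and> r \<in> braid_words n"
  by (induction rule: artin_relation.induct) (auto simp: inv_letter_def)

lemma braid_rel_words:
  "(u, v) \<in> braid_rel n \<Longrightarrow> u \<in> braid_words n \<and> v \<in> braid_words n"
  by (induction rule: braid_rel.induct) (auto dest: artin_relation_words)

lemma equiv_braid_rel: "equiv (braid_words n) (braid_rel n)"
proof (rule equivI)
  show "braid_rel n \<subseteq> braid_words n \<times> braid_words n"
    using braid_rel_words by auto
  show "refl_on (braid_words n) (braid_rel n)"
    by (auto intro!: refl_onI braid_rel.refl)
  show "Relation.sym (braid_rel n)"
    by (rule symI) (rule braid_rel.sym)
  show "Relation.trans (braid_rel n)"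
    by (rule transI) (rule braid_rel.trans)
qed

lemma braid_rel_context:
  assumes "(u, v) \<in> braid_rel n" "x \<in> braid_words n" "y \<in> braid_words n"
  shows "(x @ u @ y, x @ v @ y) \<in> braid_rel n"
  using assms
proof (induction rule: braid_rel.induct)
  case (step x' y' l r)
  then show ?case
    using braid_rel.step[of "x @ x'" n "y' @ y" l r] by simp
qed (auto intro: braid_rel.intros)

lemma braid_rel_append:
  assumes "(u, u') \<in> braid_rel n" "(v, v') \<in> braid_rel n"
  shows "(u @ v, u' @ v') \<in> braid_rel n"
proof -
  have "(u @ v, u' @ v) \<in> braid_rel n"
    using braid_rel_context[OF assms(1), of "[]" v] braid_rel_words[OF assms(2)] by simp
  moreover have "(u' @ v, u' @ v') \<in> braid_rel n"
    using braid_rel_context[OF assms(2), of u' "[]"] braid_rel_words[OF assms(1)] by simp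
  ultimately show ?thesis by (rule braid_rel.trans)
qed

lemma braid_of_word_eq_iff:
  assumes "u \<in> braid_words n" "v \<in> braid_words n"
  shows "braid_of_word n u = braid_of_word n v \<longleftrightarrow> (u, v) \<in> braid_rel n"
  unfolding braid_of_word_def using eq_equiv_class_iff[OF equiv_braid_rel] assms by blast

lemma carrier_braid_group: "carrier (braid_group n) = braid_of_word n ` braid_words n"
  by (auto simp: braid_group_def braid_of_word_def quotient_def)

lemma braid_of_word_append:
  assumes "u \<in> braid_words n" "v \<in> braid_words n"
  shows "braid_of_word n u \<otimes>\<^bsub>braid_group n\<^esub> braid_of_word n v = braid_of_word n (u @ v)"
proof -
  have "braid_rel n `` {u' @ v' | u' v'. (u, u') \<in> braid_rel n \<and> (v, v') \<in> braid_rel n}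
      = braid_rel n `` {u @ v}" (is "?L = ?R")
  proof
    show "?L \<subseteq> ?R"
      by (auto intro: braid_rel.trans braid_rel_append)
    show "?R \<subseteq> ?L"
      using assms by (auto intro: braid_rel.refl)
  qed
  then show ?thesis
    by (simp add: braid_group_def braid_of_word_def)
qed

lemma braid_of_word_Nil: "braid_of_word n [] = \<one>\<^bsub>braid_group n\<^esub>"
  by (simp add: braid_group_def)

lemma braid_word_inverse:
  "w \<in> braid_words n \<Longrightarrow>
    rev (map inv_letter w) \<in> braid_words n \<and> (rev (map inv_letter w) @ w, []) \<in> braid_rel n"
proof (induction w)
  case Nil
  then show ?case by (simp add: braid_rel.refl)
next
  case (Cons l w)
  let ?r = "rev (map inv_letter w)"
  have l: "[inv_letter l] \<in> braid_words n" and w: "w \<in> braid_words n"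
    using Cons.prems by (auto simp: inv_letter_def)
  have "artin_relation n [inv_letter l, inv_letter (inv_letter l)] []"
    using l by (rule artin_relation.cancel)
  moreover have "inv_letter (inv_letter l) = l"
    by (simp add: inv_letter_def)
  ultimately have "(?r @ [inv_letter l, l] @ w, ?r @ [] @ w) \<in> braid_rel n"
    using Cons.IH[OF w] w by (intro braid_rel.step) simp_all
  moreover have "(?r @ [] @ w, []) \<in> braid_rel n"
    using Cons.IH[OF w] by simp
  ultimately have "(?r @ [inv_letter l, l] @ w, []) \<in> braid_rel n"
    by (rule braid_rel.trans)
  then show ?case using Cons.IH[OF w] l by simp
qed

lemma group_braid_group: "group (braid_group n)"
proof (rule groupI)
  fix x assume "x \<in> carrier (braid_group n)"
  then obtain w where w: "w \<in> braid_words n" "x = braid_of_word n w"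
    by (auto simp: carrier_braid_group)
  let ?r = "rev (map inv_letter w)"
  have "braid_of_word n ?r \<otimes>\<^bsub>braid_group n\<^esub> x = \<one>\<^bsub>braid_group n\<^esub>"
    using w braid_word_inverse[OF w(1)]
    by (simp add: braid_of_word_append braid_of_word_eq_iff flip: braid_of_word_Nil)
  then show "\<exists>y\<in>carrier (braid_group n). y \<otimes>\<^bsub>braid_group n\<^esub> x = \<one>\<^bsub>braid_group n\<^esub>"
    using braid_word_inverse[OF w(1)] by (auto simp: carrier_braid_group)
qed (auto simp: carrier_braid_group braid_of_word_append simp flip: braid_of_word_Nil)

lemma inv_braid_gen:
  assumes "1 \<le> i" "i < n"
  shows "inv\<^bsub>braid_group n\<^esub> braid_gen n i = braid_of_word n [(i, False)]"
proof (rule group.inv_equality[OF group_braid_group])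
  show "braid_of_word n [(i, False)] \<otimes>\<^bsub>braid_group n\<^esub> braid_gen n i = \<one>\<^bsub>braid_group n\<^esub>"
    using assms braid_word_inverse[of "[(i, True)]" n]
    by (simp add: braid_gen_def braid_of_word_append braid_of_word_eq_iff inv_letter_def
        flip: braid_of_word_Nil)
qed (use assms in \<open>auto simp: braid_gen_def carrier_braid_group\<close>)

lemma braid_rel_mono: "(u, v) \<in> braid_rel n \<Longrightarrow> n \<le> m \<Longrightarrow> (u, v) \<in> braid_rel m"
proof (induction rule: braid_rel.induct)
  case (step x y l r)
  have words: "braid_words n \<subseteq> braid_words m"
    using step.prems by (force simp: braid_words_def)
  from step.hyps(3) have "artin_relation m l r"
    using step.prems words
    by cases (auto intro: artin_relation.cancel artin_relation.commute
        artin_relation.braid[simplified])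
  then show ?case
    using step words by (auto intro!: braid_rel.step)
next
  case (refl w)
  then have "w \<in> braid_words m"
    by (force simp: braid_words_def)
  then show ?case by (rule braid_rel.refl)
qed (auto intro: braid_rel.sym braid_rel.trans)

lemma braid_incl_braid_of_word:
  assumes "w \<in> braid_words n"
  shows "braid_incl n (braid_of_word n w) = braid_of_word (n + 1) w"
  unfolding braid_incl_def braid_of_word_def
  using assms braid_rel_mono[of _ _ n "n + 1"] by (auto intro: braid_rel.refl braid_rel.trans)

lemma torus_word_words: "torus_word p a \<in> braid_words p"
  by (auto simp: torus_word_def braid_words_def in_lists_conv_set)

lemma braid_of_torus_word:
  "braid_of_word p (torus_word p a) = braid_of_word p (torus_word p 1) [^]\<^bsub>braid_group p\<^esub> a"
proof (induction a)
  case 0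
  then show ?case
    using group_braid_group[of p]
    by (simp add: torus_word_def braid_of_word_Nil)
next
  case (Suc a)
  have "torus_word p (Suc a) = torus_word p a @ torus_word p 1"
    by (simp add: torus_word_def replicate_append_same flip: concat_append)
       (metis append_self_conv concat.simps concat_append replicate_append_same)
  then show ?case
    using Suc by (simp add: nat_pow_def braid_of_word_append[symmetric] torus_word_words)
qed

end

theory Submission imports Defs begin

text \<open>
  The crossing changes undo the half twist that \<open>a\<close> of the strands make among themselves. Hence
  the changed braid is the positive braid in which \<open>a\<close> parallel strands cross \<open>b = p - a\<close> parallel
  strands once each. Peeling off the last of the \<open>b\<close> strands leaves a single letter \<open>\<sigma>\<^bsub>a+b-1\<^esub>\<close>, which a destabilization
  removes; the remaining \<open>a - 1\<close> letters of that strand slide through the crossing onto the first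
  \<open>a\<close> strands, where they form \<open>\<sigma>\<^bsub>a-1\<^esub> \<dots> \<sigma>\<^sub>1\<close>. After \<open>b\<close> rounds only
  \<open>(\<sigma>\<^bsub>a-1\<^esub> \<dots> \<sigma>\<^sub>1)\<^sup>b\<close> is left, which the half twist conjugates to
  \<open>(\<sigma>\<^sub>1 \<dots> \<sigma>\<^bsub>a-1\<^esub>)\<^sup>b\<close>.
\<close>

subsection \<open>The positive braid monoid\<close>

text \<open>The positive relations preserve the set of letters of a word, so no number of strands has to
  be fixed.\<close>

inductive pos_eq :: "nat list \<Rightarrow> nat list \<Rightarrow> bool" (infix \<open>\<approx>\<close> 50) where
  refl [simp, intro]: "u \<approx> u"
| sym: "u \<approx> v \<Longrightarrow> v \<approx> u"
| trans [trans]: "u \<approx> v \<Longrightarrow> v \<approx> w \<Longrightarrow> u \<approx> w"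
| commute: "i + 2 \<le> j \<Longrightarrow> x @ [i, j] @ y \<approx> x @ [j, i] @ y"
| braid: "x @ [i, Suc i, i] @ y \<approx> x @ [Suc i, i, Suc i] @ y"

lemma pos_eq_set: "u \<approx> v \<Longrightarrow> set u = set v"
  by (induction rule: pos_eq.induct) auto

lemma pos_eq_context: "u \<approx> v \<Longrightarrow> x @ u @ y \<approx> x @ v @ y"
proof (induction rule: pos_eq.induct)
  case (commute i j x' y')
  then show ?case using pos_eq.commute[of i j "x @ x'" "y' @ y"] by simp
next
  case (braid x' i y')
  then show ?case using pos_eq.braid[of "x @ x'" i "y' @ y"] by simp
qed (auto intro: pos_eq.intros)

lemma pos_eq_append: "u \<approx> u' \<Longrightarrow> v \<approx> v' \<Longrightarrow> u @ v \<approx> u' @ v'"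
  using pos_eq_context[of u u' "[]" v] pos_eq_context[of v v' u' "[]"]
  by (auto intro: pos_eq.trans)

lemma pos_eq_append_left: "u \<approx> v \<Longrightarrow> x @ u \<approx> x @ v"
  by (rule pos_eq_append) auto

lemma pos_eq_append_right: "u \<approx> v \<Longrightarrow> u @ y \<approx> v @ y"
  by (rule pos_eq_append) auto

lemma pos_eq_rev: "u \<approx> v \<Longrightarrow> rev u \<approx> rev v"
proof (induction rule: pos_eq.induct)
  case (commute i j x y)
  then show ?case using pos_eq.commute[of i j "rev y" "rev x"] by (simp add: pos_eq.sym)
next
  case (braid x i y)
  then show ?case using pos_eq.braid[of "rev y" i "rev x"] by simp
qed (auto intro: pos_eq.intros)

lemma pos_eq_commute_letter:
  assumes "\<forall>j\<in>set v. i + 2 \<le> j \<or> j + 2 \<le> i"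
  shows "i # v \<approx> v @ [i]"
  using assms
proof (induction v)
  case (Cons j v)
  have "i # j # v \<approx> j # i # v"
    using Cons.prems pos_eq.commute[of i j "[]" v] pos_eq.commute[of j i "[]" v]
    by (auto intro: pos_eq.sym)
  also have "j # i # v \<approx> j # v @ [i]"
    using Cons pos_eq_append[of "[j]" "[j]"] by simp
  finally show ?case by simp
qed simp

text \<open>The letter \<open>k\<close> travels left: it commutes with \<open>[k + 2..<m]\<close>,
  the braid relation on \<open>k, Suc k, k\<close> turns it into \<open>Suc k\<close>, and that
  letter commutes with \<open>[j..<k]\<close>.\<close>

lemma shift_letter:
  assumes "j \<le> k" "Suc k < m"
  shows "[j..<m] @ [k] \<approx> Suc k # [j..<m]"
proof -
  have "[j..<Suc (Suc k)] @ [Suc (Suc k)..<m] = [j..<m]"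
    using assms by (metis Suc_leI le_SucI le_Suc_ex upt_add_eq_append)
  then have split: "[j..<m] = [j..<k] @ [k, Suc k] @ [k + 2..<m]"
    using assms by simp
  have "[j..<m] @ [k] \<approx> [j..<k] @ [k, Suc k] @ [k] @ [k + 2..<m]"
    using pos_eq.sym[OF pos_eq_commute_letter[of "[k + 2..<m]" k]]
    by (simp add: split pos_eq_append_left[where x = "[j..<k] @ [k, Suc k]", simplified])
  also have "\<dots> \<approx> [j..<k] @ [Suc k, k, Suc k] @ [k + 2..<m]"
    using pos_eq.braid[of "[j..<k]" k] by simp
  also have "\<dots> = ([j..<k] @ [Suc k]) @ [k, Suc k] @ [k + 2..<m]" by simp
  also have "\<dots> \<approx> (Suc k # [j..<k]) @ [k, Suc k] @ [k + 2..<m]"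
    by (intro pos_eq_append_right pos_eq.sym[OF pos_eq_commute_letter]) auto
  finally show ?thesis unfolding split by simp
qed

lemma shift_word:
  assumes "\<forall>k\<in>set u. j \<le> k \<and> Suc k < m"
  shows "[j..<m] @ u \<approx> map Suc u @ [j..<m]"
  using assms
proof (induction u)
  case (Cons k u)
  have "[j..<m] @ [k] @ u \<approx> [Suc k] @ [j..<m] @ u"
    using pos_eq_append_right[OF shift_letter, of j k m u] Cons.prems by simp
  also have "\<dots> \<approx> [Suc k] @ map Suc u @ [j..<m]"
    using Cons by (intro pos_eq_append_left) auto
  finally show ?case by simp
qed simp

text \<open>This is \<open>shift_word\<close> for \<open>[j..<m - 1]\<close> read from right to
  left; it moves a word past one row of \<open>band_crossing\<close>.\<close>

lemma shift_upt: "[Suc j..<m] @ [j..<m] \<approx> [j..<m] @ [j..<m - 1]"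
  using pos_eq.sym[OF shift_word[of "[j..<m - 1]" j m]]
  by (cases m) (auto simp: map_Suc_upt)

lemma shift_rev_upt: "rev [j..<m] @ rev [Suc j..<m] \<approx> rev [j..<m - 1] @ rev [j..<m]"
  using pos_eq_rev[OF shift_upt[of j m]] by simp

subsection \<open>Two bands of parallel strands crossing each other\<close>

text \<open>Each row takes one strand of the left band across all \<open>b\<close> strands of the
  right band, beginning with the strand next to that band.\<close>

primrec band_crossing :: "nat \<Rightarrow> nat \<Rightarrow> nat list" where
  "band_crossing 0 b = []"
| "band_crossing (Suc a) b = [Suc a..<Suc a + b] @ band_crossing a b"

lemma set_band_crossing: "set (band_crossing a b) \<subseteq> {1..<a + b}"
  by (induction a) auto

lemma band_crossing_0_right [simp]: "band_crossing a 0 = []"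
  by (induction a) auto

text \<open>The last letter of each row belongs to the extra strand. It exceeds every letter of the
  shorter rows below by at least two, so these letters can be collected at the end.\<close>

lemma band_crossing_Suc_right:
  "band_crossing a (Suc b) \<approx> band_crossing a b @ rev [Suc b..<Suc b + a]"
proof (induction a)
  case (Suc a)
  let ?X = "band_crossing a b" and ?T = "rev [Suc b..<Suc b + a]"
  have "band_crossing (Suc a) (Suc b) \<approx> [Suc a..<Suc a + Suc b] @ ?X @ ?T"
    unfolding band_crossing.simps append_assoc by (intro pos_eq_append_left Suc)
  also have "\<dots> = [Suc a..<Suc a + b] @ (Suc (a + b) # ?X) @ ?T" by simp
  also have "\<dots> \<approx> [Suc a..<Suc a + b] @ (?X @ [Suc (a + b)]) @ ?T"
    using set_band_crossing[of a b]
    by (intro pos_eq_append_left pos_eq_append_right pos_eq_commute_letter) fastforce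
  finally show ?case by (simp add: add.commute)
qed simp

text \<open>A word among the \<open>b\<close> strands may be read before or after they cross the
  other band, with indices differing by \<open>a\<close>. Each row passed lowers them by
  one.\<close>

lemma band_crossing_slide_upt:
  "[Suc a..<a + b] @ band_crossing a b \<approx> band_crossing a b @ [1..<b]"
proof (induction a)
  case (Suc a)
  have "[Suc (Suc a)..<Suc a + b] @ [Suc a..<Suc a + b] @ band_crossing a b
      \<approx> [Suc a..<Suc a + b] @ [Suc a..<a + b] @ band_crossing a b"
    using pos_eq_append_right[OF shift_upt[of "Suc a" "Suc a + b"]] by simp
  also have "\<dots> \<approx> [Suc a..<Suc a + b] @ band_crossing a b @ [1..<b]"
    by (intro pos_eq_append_left Suc)
  finally show ?case by simp
qed simp

text \<open>The same slide for the \<open>a\<close> strands. The induction adds one column from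
  \<open>band_crossing_Suc_right\<close> at a time, and passing it shifts the indices by
  one.\<close>

lemma band_crossing_slide_rev_upt:
  "band_crossing a b @ rev [Suc b..<b + a] \<approx> rev [1..<a] @ band_crossing a b"
proof (induction b)
  case (Suc b)
  let ?X = "band_crossing a b" and ?T = "rev [Suc b..<Suc b + a]"
  have "band_crossing a (Suc b) @ rev [Suc (Suc b)..<Suc b + a]
      \<approx> ?X @ ?T @ rev [Suc (Suc b)..<Suc b + a]"
    using pos_eq_append_right[OF band_crossing_Suc_right] by simp
  also have "\<dots> \<approx> ?X @ rev [Suc b..<b + a] @ ?T"
    using pos_eq_append_left[OF shift_rev_upt[of "Suc b" "Suc b + a"]] by simp
  also have "\<dots> \<approx> rev [1..<a] @ ?X @ ?T"
    using pos_eq_append_right[OF Suc] by simp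
  also have "\<dots> \<approx> rev [1..<a] @ band_crossing a (Suc b)"
    by (intro pos_eq_append_left pos_eq.sym[OF band_crossing_Suc_right])
  finally show ?case .
qed simp

text \<open>One strand changes from the right band to the left, at the cost of a tail. Both sides
  equal \<open>[Suc a..<a + Suc b] @ band_crossing a (Suc b)\<close>: slide
  \<open>[1..<Suc b]\<close> through, or split off a column.\<close>

lemma band_crossing_Suc_left:
  "band_crossing a (Suc b) @ [1..<Suc b] \<approx> band_crossing (Suc a) b @ rev [Suc b..<Suc b + a]"
proof -
  have "band_crossing a (Suc b) @ [1..<Suc b] \<approx> [Suc a..<a + Suc b] @ band_crossing a (Suc b)"
    by (rule pos_eq.sym[OF band_crossing_slide_upt])
  also have "\<dots> \<approx> [Suc a..<a + Suc b] @ band_crossing a b @ rev [Suc b..<Suc b + a]"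
    by (intro pos_eq_append_left band_crossing_Suc_right)
  finally show ?thesis by simp
qed

subsection \<open>The half twist\<close>

text \<open>This is Garside's fundamental element on \<open>n\<close> strands.\<close>

primrec half_twist :: "nat \<Rightarrow> nat list" where
  "half_twist 0 = []"
| "half_twist (Suc n) = [1..<Suc n] @ half_twist n"

lemma set_half_twist: "set (half_twist n) \<subseteq> {1..<n}"
  by (induction n) auto

lemma half_twist_Suc_right: "half_twist (Suc n) \<approx> half_twist n @ rev [1..<Suc n]"
proof (induction n)
  case (Suc n)
  have "half_twist (Suc (Suc n)) \<approx> [1..<Suc (Suc n)] @ half_twist n @ rev [1..<Suc n]"
    unfolding half_twist.simps(2)[of "Suc n"] by (intro pos_eq_append_left Suc)
  also have "\<dots> = [1..<Suc n] @ (Suc n # half_twist n) @ rev [1..<Suc n]" by simp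
  also have "\<dots> \<approx> [1..<Suc n] @ (half_twist n @ [Suc n]) @ rev [1..<Suc n]"
    using set_half_twist[of n]
    by (intro pos_eq_append_left pos_eq_append_right pos_eq_commute_letter) fastforce
  finally show ?case by simp
qed simp

text \<open>The half twist on \<open>n = Suc m\<close> strands is
  \<open>[1..<n] @ half_twist m\<close> and also \<open>half_twist m @ rev [1..<n]\<close>; the
  first form is used on the left, the second on the right.\<close>

lemma half_twist_conjugates: "half_twist n @ rev [1..<n] \<approx> [1..<n] @ half_twist n"
proof (cases n)
  case (Suc m)
  have "[1..<n] @ half_twist m @ rev [1..<n] \<approx> [1..<n] @ half_twist n"
    unfolding Suc by (intro pos_eq_append_left pos_eq.sym[OF half_twist_Suc_right])
  then show ?thesis by (simp add: Suc)
qed simp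

lemma half_twist_conjugates_power:
  "half_twist n @ concat (replicate b (rev [1..<n]))
    \<approx> concat (replicate b [1..<n]) @ half_twist n"
proof (induction b)
  case (Suc b)
  have "half_twist n @ rev [1..<n] @ concat (replicate b (rev [1..<n]))
      \<approx> [1..<n] @ half_twist n @ concat (replicate b (rev [1..<n]))"
    using pos_eq_append_right[OF half_twist_conjugates] by simp
  also have "\<dots> \<approx> [1..<n] @ concat (replicate b [1..<n]) @ half_twist n"
    by (intro pos_eq_append_left Suc)
  finally show ?case by simp
qed simp

subsection \<open>Positive words as braids\<close>

abbreviation pos_word :: "nat list \<Rightarrow> braid_word" where
  "pos_word \<equiv> map (\<lambda>i. (i, True))"

lemma pos_word_braid_words: "pos_word u \<in> braid_words n \<longleftrightarrow> set u \<subseteq> {1..<n}"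
  by (induction u) auto

text \<open>Bounding the letters of \<open>u\<close> suffices, since \<open>pos_eq_set\<close>
  carries the bound to the other words in the symmetric and transitive cases.\<close>

lemma pos_eq_braid_rel:
  "u \<approx> v \<Longrightarrow> set u \<subseteq> {1..<n} \<Longrightarrow> (pos_word u, pos_word v) \<in> braid_rel n"
proof (induction rule: pos_eq.induct)
  case (refl u)
  then show ?case by (simp add: braid_rel.refl pos_word_braid_words)
next
  case (sym u v)
  then show ?case using pos_eq_set by (blast intro: braid_rel.sym)
next
  case (trans u v w)
  then show ?case using pos_eq_set by (blast intro: braid_rel.trans)
next
  case (commute i j x y)
  then show ?case
    using braid_rel.step[OF _ _ artin_relation.commute[of i j n], of "pos_word x" "pos_word y"]
    by (auto simp: pos_word_braid_words)
next
  case (braid x i y)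
  then show ?case
    using braid_rel.step[OF _ _ artin_relation.braid[of i n], of "pos_word x" "pos_word y"]
    by (auto simp: pos_word_braid_words)
qed

lemma braid_of_pos_word_cong:
  assumes "u \<approx> v" "set u \<subseteq> {1..<n}"
  shows "braid_of_word n (pos_word u) = braid_of_word n (pos_word v)"
  using pos_eq_braid_rel[OF assms] assms pos_eq_set[OF assms(1)]
  by (simp add: braid_of_word_eq_iff pos_word_braid_words)

subsection \<open>Markov equivalence of words\<close>

lemma markov_equiv_refl [simp]: "markov_equiv x x"
  by (simp add: markov_equiv_def)

lemma markov_equiv_trans [trans]: "markov_equiv x y \<Longrightarrow> markov_equiv y z \<Longrightarrow> markov_equiv x z"
  unfolding markov_equiv_def by (rule equivclp_trans)

lemma markov_equiv_rotate:
  assumes "1 \<le> n" "u \<in> braid_words n" "v \<in> braid_words n"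
  shows "markov_equiv (n, braid_of_word n (u @ v)) (n, braid_of_word n (v @ u))"
proof -
  interpret group "braid_group n" by (rule group_braid_group)
  have carrier: "braid_of_word n w \<in> carrier (braid_group n)" if "w \<in> braid_words n" for w
    using that by (simp add: carrier_braid_group)
  have "braid_of_word n v \<otimes>\<^bsub>braid_group n\<^esub> braid_of_word n (u @ v)
        \<otimes>\<^bsub>braid_group n\<^esub> inv\<^bsub>braid_group n\<^esub> braid_of_word n v
      = braid_of_word n (v @ u)"
    using assms carrier by (simp add: m_assoc flip: braid_of_word_append)
  then show ?thesis
    using markov_move.conjugation[OF assms(1) carrier carrier, of "u @ v" v] assms
    unfolding markov_equiv_def by (metis r_into_equivclp braid_words_append)
qed

lemma markov_equiv_destabilize:
  assumes "1 \<le> n" "w \<in> braid_words n"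
  shows "markov_equiv (Suc n, braid_of_word (Suc n) (w @ [(n, True)])) (n, braid_of_word n w)"
proof -
  have w: "w \<in> braid_words (Suc n)"
    using assms by (force simp: braid_words_def)
  have "markov_move (n, braid_of_word n w)
      (n + 1, braid_incl n (braid_of_word n w) \<otimes>\<^bsub>braid_group (n + 1)\<^esub> braid_gen (n + 1) n)"
    using assms by (intro markov_move.stabilization_pos) (simp_all add: carrier_braid_group)
  then have "markov_move (n, braid_of_word n w)
      (Suc n, braid_of_word (Suc n) (w @ [(n, True)]))"
    using assms w by (simp add: braid_incl_braid_of_word braid_gen_def braid_of_word_append)
  then show ?thesis
    unfolding markov_equiv_def by (blast intro: equivclp_sym)
qed

text \<open>The prefix \<open>u\<close> accumulates the words \<open>rev [1..<a]\<close> left by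
  finished rounds, so the induction on \<open>b\<close> is generalized over it.\<close>

lemma markov_equiv_band_crossing:
  assumes "1 \<le> a" "set u \<subseteq> {1..<a}"
  shows "markov_equiv (a + b, braid_of_word (a + b) (pos_word (u @ band_crossing a b)))
    (a, braid_of_word a (pos_word (u @ concat (replicate b (rev [1..<a])))))"
  using assms(2)
proof (induction b arbitrary: u)
  case (Suc b)
  let ?n = "a + b" and ?X = "band_crossing a b" and ?T = "rev [Suc b..<b + a]"
  let ?u = "u @ rev [1..<a]"
  have X: "set ?X \<subseteq> {1..<?n}" and u: "set u \<subseteq> {1..<?n}" and T: "set ?T \<subseteq> {1..<?n}"
    using set_band_crossing[of a b] Suc.prems by fastforce+
  have mono: "{1..<?n} \<subseteq> {1..<Suc ?n}" by auto
  have "u @ band_crossing a (Suc b) \<approx> u @ ?X @ rev [Suc b..<Suc b + a]"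
    by (intro pos_eq_append_left band_crossing_Suc_right)
  \<comment> \<open>The new column starts with the top letter \<open>?n\<close>, because
    \<open>1 \<le> a\<close> makes it nonempty; \<open>?n\<close> occurs nowhere else in the
    word.\<close>
  also have "u @ ?X @ rev [Suc b..<Suc b + a] = (u @ ?X @ [?n]) @ ?T"
    using assms(1) by (simp add: add.commute)
  finally have "braid_of_word (Suc ?n) (pos_word (u @ band_crossing a (Suc b)))
      = braid_of_word (Suc ?n) (pos_word (u @ ?X @ [?n]) @ pos_word ?T)"
    using u mono set_band_crossing[of a "Suc b"]
    by (subst braid_of_pos_word_cong) auto
  \<comment> \<open>Destabilization needs \<open>?n\<close> as the last letter, so \<open>?T\<close>
    is rotated to the front.\<close>
  also have "markov_equiv (Suc ?n, braid_of_word (Suc ?n) (pos_word (u @ ?X @ [?n]) @ pos_word ?T))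
      (Suc ?n, braid_of_word (Suc ?n) (pos_word ?T @ pos_word (u @ ?X @ [?n])))"
    using X u T mono assms(1) by (intro markov_equiv_rotate) (auto simp: pos_word_braid_words)
  also have "markov_equiv \<dots> (?n, braid_of_word ?n (pos_word ?T @ pos_word (u @ ?X)))"
    using markov_equiv_destabilize[of ?n "pos_word ?T @ pos_word (u @ ?X)"] X u T assms(1)
    by (simp add: pos_word_braid_words)
  \<comment> \<open>Rotating back puts \<open>?T\<close> behind \<open>?X\<close>, where it can
    slide through the crossing and join \<open>u\<close>.\<close>
  also have "markov_equiv \<dots> (?n, braid_of_word ?n (pos_word (u @ ?X) @ pos_word ?T))"
    using X u T assms(1) by (intro markov_equiv_rotate) (auto simp: pos_word_braid_words)
  also have "braid_of_word ?n (pos_word (u @ ?X) @ pos_word ?T)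
      = braid_of_word ?n (pos_word (?u @ ?X))"
    using braid_of_pos_word_cong[OF pos_eq_append_left[OF band_crossing_slide_rev_upt],
        of u a b ?n] X u T by simp
  also have "markov_equiv (?n, \<dots>)
      (a, braid_of_word a (pos_word (?u @ concat (replicate b (rev [1..<a])))))"
    using Suc.prems by (intro Suc.IH) auto
  finally show ?case by simp
qed simp

subsection \<open>The changed torus braid\<close>

lemma torus_word_eq: "torus_word p b = pos_word (concat (replicate b [1..<p]))"
  by (simp add: torus_word_def map_concat)

lemma torus_word_Suc: "torus_word p (Suc c) = torus_word p c @ pos_word [1..<p]"
  by (simp add: torus_word_def flip: replicate_append_same)

lemma length_torus_word [simp]: "length (torus_word p c) = c * (p - 1)"
  by (induction c) (auto simp: torus_word_def)

lemma change_crossings_append: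
  "change_crossings S (u @ v) = change_crossings S u @
    map (\<lambda>(k, l). if k \<in> S then inv_letter l else l) (enumerate (Suc (length u)) v)"
  by (simp add: change_crossings_def enumerate_append_eq)

lemma U_data_row:
  assumes "c < a" "a < p" "1 \<le> k" "k < p"
  shows "c * (p - 1) + k \<in> U_data p a \<longleftrightarrow> p - c \<le> k"
proof
  assume "c * (p - 1) + k \<in> U_data p a"
  then obtain i t where it: "c * (p - 1) + k = i * (p - 1) - t" "2 \<le> i" "i \<le> a" "t \<le> i - 2"
    by (auto simp: U_data_def)
  \<comment> \<open>This rules out truncation in \<open>i * (p - 1) - t\<close>, as
    \<open>t < p - 1\<close>. The same bound keeps the changed crossings of factor \<open>i\<close>
    inside that factor, which forces \<open>i = Suc c\<close>.\<close>
  have "p - 1 \<le> i * (p - 1)" using it(2) by simp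
  then have eq: "c * (p - 1) + k + t = i * (p - 1)"
    using it assms by linarith
  have "c < i"
  proof (rule ccontr)
    assume "\<not> c < i"
    then have "i * (p - 1) \<le> c * (p - 1)" by (intro mult_le_mono1) simp
    then show False using eq assms by linarith
  qed
  moreover have "i < Suc (Suc c)"
  proof (rule ccontr)
    assume "\<not> i < Suc (Suc c)"
    then have "Suc (Suc c) * (p - 1) \<le> i * (p - 1)" by (intro mult_le_mono1) simp
    then show False using eq it assms by simp
  qed
  ultimately have "i = Suc c" by simp
  then show "p - c \<le> k" using eq it assms by simp
next
  assume "p - c \<le> k"
  then have "c * (p - 1) + k = Suc c * (p - 1) - (p - 1 - k)" "2 \<le> Suc c" "p - 1 - k \<le> Suc c - 2"
    using assms by auto
  then show "c * (p - 1) + k \<in> U_data p a"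
    using assms unfolding U_data_def by (metis (mono_tags, lifting) Suc_leI mem_Collect_eq)
qed

lemma changed_row:
  assumes "c < a" "a < p"
  shows "map (\<lambda>(k, l). if k \<in> U_data p a then inv_letter l else l)
      (enumerate (Suc (c * (p - 1))) (pos_word [1..<p]))
    = pos_word [1..<p - c] @ map (\<lambda>i. (i, False)) [p - c..<p]" (is "?L = ?R")
proof -
  have "?L = map (\<lambda>k. (k, k < p - c)) [1..<p]"
  proof (rule nth_equalityI)
    fix k assume "k < length ?L"
    then show "?L ! k = map (\<lambda>k. (k, k < p - c)) [1..<p] ! k"
      using U_data_row[OF assms, of "Suc k"] by (auto simp: nth_enumerate_eq inv_letter_def)
  qed simp
  also have "\<dots> = map (\<lambda>k. (k, k < p - c)) ([1..<p - c] @ [p - c..<p])"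
    using assms upt_add_eq_append[of 1 "p - c" c] by simp
  also have "\<dots> = ?R" by simp
  finally show ?thesis .
qed

lemma pos_word_cancel:
  assumes "set u \<subseteq> {1..<n}"
  shows "(pos_word u @ map (\<lambda>i. (i, False)) (rev u), []) \<in> braid_rel n"
  using assms braid_word_inverse[of "map (\<lambda>i. (i, False)) (rev u)" n]
  by (force simp: rev_map comp_def inv_letter_def braid_words_def)

text \<open>The crossing data stay those of the full word while its factors are added one by one.
  The positive part of the next factor moves a strand by \<open>band_crossing_Suc_left\<close>, and
  its changed letters \<open>?neg\<close> cancel the resulting tail \<open>?T\<close>.\<close>

lemma changed_torus_word:
  assumes "c \<le> a" "a < p"
  shows "(change_crossings (U_data p a) (torus_word p c), pos_word (band_crossing c (p - c)))
    \<in> braid_rel p"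
  using assms(1)
proof (induction c)
  case 0
  then show ?case by (simp add: change_crossings_def torus_word_def braid_rel.refl)
next
  case (Suc c)
  define b where "b = p - Suc c"
  have b: "p - c = Suc b" "p = Suc b + c" using Suc.prems assms(2) by (auto simp: b_def)
  let ?neg = "map (\<lambda>i. (i, False)) [p - c..<p]"
  let ?rest = "pos_word [1..<p - c] @ ?neg" and ?T = "rev [Suc b..<p]"
  have rest: "?rest \<in> braid_words p"
    using Suc.prems assms(2) by (fastforce simp: braid_words_def)
  have "change_crossings (U_data p a) (torus_word p (Suc c))
      = change_crossings (U_data p a) (torus_word p c) @ ?rest"
    using Suc.prems assms(2) changed_row[of c a p]
    by (simp add: torus_word_Suc change_crossings_append)
  moreover have "(change_crossings (U_data p a) (torus_word p c) @ ?rest,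
      pos_word (band_crossing c (p - c)) @ ?rest) \<in> braid_rel p"
    using Suc rest by (intro braid_rel_append braid_rel.refl) auto
  moreover have "(pos_word (band_crossing c (p - c)) @ ?rest,
      pos_word (band_crossing (Suc c) b) @ pos_word ?T @ ?neg) \<in> braid_rel p"
  proof -
    have "(pos_word (band_crossing c (Suc b) @ [1..<Suc b]),
        pos_word (band_crossing (Suc c) b @ ?T)) \<in> braid_rel p"
      using set_band_crossing[of c "Suc b"] b band_crossing_Suc_left[of c b]
      by (intro pos_eq_braid_rel) (auto simp: add.commute)
    from braid_rel_append[OF this braid_rel.refl, of ?neg] rest show ?thesis
      by (simp add: b(1) del: upt_Suc)
  qed
  moreover have "(pos_word (band_crossing (Suc c) b) @ pos_word ?T @ ?neg,
      pos_word (band_crossing (Suc c) b) @ []) \<in> braid_rel p"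
  proof (intro braid_rel_append braid_rel.refl)
    show "pos_word (band_crossing (Suc c) b) \<in> braid_words p"
      using set_band_crossing[of "Suc c" b] b by (simp add: pos_word_braid_words add.commute)
    have "set ?T \<subseteq> {1..<p}" by auto
    from pos_word_cancel[OF this] show "(pos_word ?T @ ?neg, []) \<in> braid_rel p"
      by (simp only: b(1) rev_rev_ident)
  qed
  ultimately have "(change_crossings (U_data p a) (torus_word p (Suc c)),
      pos_word (band_crossing (Suc c) b) @ []) \<in> braid_rel p"
    by (metis braid_rel.trans)
  then show ?case by (simp only: b_def append_Nil2)
qed

theorem theorem1p3:
  fixes p a :: nat
  assumes "1 \<le> a" and "a < p"
  shows "markov_equiv (p, braid_of_word p (change_crossings (U_data p a) (torus_word p a)))
                      (a, braid_of_word a (torus_word a (p - a)))"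
proof -
  define b where "b = p - a"
  let ?D = "concat (replicate b (rev [1..<a]))" and ?E = "concat (replicate b [1..<a])"
    and ?H = "half_twist a"
  interpret group "braid_group a" by (rule group_braid_group)
  have words: "set ?D \<subseteq> {1..<a}" "set ?E \<subseteq> {1..<a}" "set ?H \<subseteq> {1..<a}"
    using set_half_twist[of a] by auto
  have "braid_of_word p (change_crossings (U_data p a) (torus_word p a))
      = braid_of_word p (pos_word (band_crossing a b))"
    using changed_torus_word[OF order.refl assms(2)] braid_rel_words
    by (subst braid_of_word_eq_iff) (auto simp: b_def)
  also have "markov_equiv (p, \<dots>) (a, braid_of_word a (pos_word ?D))"
    using markov_equiv_band_crossing[OF assms(1), of "[]" b] assms(2) by (simp add: b_def)
  also have "markov_equiv \<dots> (a, braid_of_word a (pos_word ?E))"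
  proof -
    let ?d = "braid_of_word a (pos_word ?D)" and ?e = "braid_of_word a (pos_word ?E)"
      and ?h = "braid_of_word a (pos_word ?H)"
    have carrier: "?d \<in> carrier (braid_group a)" "?e \<in> carrier (braid_group a)"
      "?h \<in> carrier (braid_group a)"
      using words by (simp_all add: carrier_braid_group pos_word_braid_words)
    \<comment> \<open>The half twist reverses each factor, so conjugation by \<open>?h\<close> turns
      \<open>?d\<close> into \<open>?e\<close>.\<close>
    have "?h \<otimes>\<^bsub>braid_group a\<^esub> ?d = ?e \<otimes>\<^bsub>braid_group a\<^esub> ?h"
      using braid_of_pos_word_cong[OF half_twist_conjugates_power, of a b a] words
      by (simp add: braid_of_word_append pos_word_braid_words)
    then have "?h \<otimes>\<^bsub>braid_group a\<^esub> ?d \<otimes>\<^bsub>braid_group a\<^esub> inv\<^bsub>braid_group a\<^esub> ?h = ?e"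
      using carrier by (simp add: m_assoc)
    then show ?thesis
      using markov_move.conjugation[OF assms(1) carrier(1,3)]
      unfolding markov_equiv_def by (simp add: r_into_equivclp)
  qed
  finally show ?thesis by (simp add: torus_word_eq b_def)
qed

end
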